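(* For all integers $\alpha\geq 1$ and all integers $n\geq 0$, $$pond\left(3^{2\alpha+1}n+\frac{23\cdot 3^{2\alpha}+1}{8}\right) \equiv 0 \pmod{3}.$$
   Context: A POND partition is an integer partition in which the odd parts are not allowed to be distinct, i.e., no odd part appears with multiplicity exactly one (every odd part that occurs appears at least twice), while the even parts are unrestricted. For an integer $n\geq 0$, $pond(n)$ denotes the number of POND partitions of weight $n$, i.e., POND partitions whose parts sum to $n$ (the empty partition is counted, so $pond(0)=1$). *)

theory Defs
  imports "HOL-Library.Multiset" "HOL-Number_Theory.Number_Theory"
begin

text \<open>A partition is the finite multiset of its parts, so the empty partition is the only
  partition of 0.\<close>

definition partition_of :: "nat \<Rightarrow> nat multiset \<Rightarrow> bool" where
  "partition_of n M \<longleftrightarrow> (\<forall>p \<in># M. p > 0) \<and> sum_mset M = n"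

definition POND :: "nat multiset \<Rightarrow> bool" where
  "POND M \<longleftrightarrow> (\<forall>p \<in># M. odd p \<longrightarrow> count M p \<noteq> 1)"

definition pond :: "nat \<Rightarrow> nat" where
  "pond n = card {M. partition_of n M \<and> POND M}"

text \<open>The sets counted by \<^const>\<open>pond\<close> are finite, so the cardinality is the genuine one.\<close>

lemma size_le_sum_mset:
  fixes M :: "nat multiset"
  assumes "\<forall>p \<in># M. p > 0"
  shows "size M \<le> sum_mset M"
  using assms by (induction M) auto

lemma finite_partition_of: "finite {M. partition_of n M}"
proof (rule finite_subset)
  show "{M. partition_of n M} \<subseteq> mset ` {xs. set xs \<subseteq> {..n} \<and> length xs \<le> n}"
  proof
    fix M assume "M \<in> {M. partition_of n M}"
    then have M: "\<forall>p \<in># M. p > 0" "sum_mset M = n"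
      by (auto simp: partition_of_def)
    obtain xs where xs: "mset xs = M"
      using ex_mset by blast
    have "p \<le> n" if "p \<in># M" for p
      using M(2) that by (auto dest!: multi_member_split)
    then have "set xs \<subseteq> {..n}"
      using xs by auto
    moreover have "length xs \<le> n"
      using size_le_sum_mset[OF M(1)] M(2) xs by auto
    ultimately show "M \<in> mset ` {xs. set xs \<subseteq> {..n} \<and> length xs \<le> n}"
      using xs by auto
  qed
  show "finite (mset ` {xs. set xs \<subseteq> {..n} \<and> length xs \<le> n})"
    by (intro finite_imageI finite_lists_length_le) simp
qed

lemma finite_POND_partitions: "finite {M. partition_of n M \<and> POND M}"
  by (rule finite_subset[OF _ finite_partition_of[of n]]) auto

lemma pond_0: "pond 0 = 1"
proof -
  have "{M. partition_of 0 M \<and> POND M} = {{#}}"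
    by (auto simp: partition_of_def POND_def) (metis less_numeral_extra(3) multiset_nonemptyE)
  then show ?thesis
    by (simp add: pond_def)
qed

text \<open>The offset \<open>(23 * 3^(2\<alpha>) + 1) / 8\<close> is an integer, so natural-number division is exact
  there.\<close>

lemma eight_dvd_offset: "(8::nat) dvd 23 * 3 ^ (2 * \<alpha>) + 1"
proof (induction \<alpha>)
  case (Suc \<alpha>)
  have "(23::nat) * 3 ^ (2 * Suc \<alpha>) + 1 = (23 * 3 ^ (2 * \<alpha>) + 1) + 8 * (23 * 3 ^ (2 * \<alpha>))"
    by simp
  then show ?case
    using dvd_add[OF Suc dvd_triv_left] by presburger
qed simp

end

theory Submission
  imports Defs "HOL-Computational_Algebra.Formal_Power_Series" "HOL-Library.Numeral_Type"
begin

text \<open>All series live over the type \<open>3\<close>, the ring of integers modulo 3, where \<open>F(q)^3 = F(q^3)\<close>.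
  Let \<open>f = \<psi>(q)\<close> and \<open>g = \<psi>(-q)\<close>, where \<open>\<psi>(q)\<close> is the sum of \<open>q^(k(k+1)/2)\<close> over \<open>k \<ge> 0\<close>. By
  Gauss's product for \<open>\<psi>\<close>, the generating function of \<open>pond\<close> is \<open>f / g^2 = f g / g^3\<close>. Triangular
  numbers are never 2 modulo 3, and those that are 1 modulo 3 are the numbers \<open>9 t + 1\<close> with \<open>t\<close>
  triangular; hence \<open>f = a^3 + q f^9\<close> and \<open>g = b^3 - q g^9\<close>. Extracting the exponents
  \<open>3 n + 2\<close> turns \<open>f g / g^3\<close> into \<open>- K\<close> with \<open>K = f^3 g^2\<close>, and \<open>K\<close> into \<open>C = f g^6\<close>. Finally,
  \<open>C\<close> has no exponents \<open>3 n + 2\<close>, while its exponents \<open>3 n + 1\<close> give back \<open>K\<close>, which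
  drives the induction on \<open>\<alpha>\<close>.\<close>

unbundle fps_syntax

section \<open>Multisets with prescribed multiplicities\<close>

definition restricted_partitions ::
    "(nat \<Rightarrow> nat set) \<Rightarrow> nat \<Rightarrow> nat \<Rightarrow> nat multiset set" where
  "restricted_partitions A N n =
     {M. set_mset M \<subseteq> {1..N} \<and> (\<forall>p \<in># M. count M p \<in> A p) \<and> sum_mset M = n}"

text \<open>For \<open>p > 0\<close> this is the sum of q^(p c) over \<open>c\<close> in
  \<open>S\<close>, the factor contributed by the part \<open>p\<close>.\<close>

definition part_series :: "nat set \<Rightarrow> nat \<Rightarrow> 'a::comm_ring_1 fps" where
  "part_series S p = Abs_fps (\<lambda>m. of_bool (p dvd m \<and> m div p \<in> S))"

lemma finite_restricted_partitions [simp]: "finite (restricted_partitions A N n)"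
  by (rule finite_subset[OF _ finite_partition_of[of n]])
    (fastforce simp: restricted_partitions_def partition_of_def)

text \<open>Strip the copies of the largest part \<open>Suc N\<close>. Indexing by the remaining sum
  \<open>i\<close>, not by the multiplicity, turns the count into a Cauchy product.\<close>

lemma restricted_partitions_Suc:
  assumes "\<And>p. 0 \<in> A p"
  shows "restricted_partitions A (Suc N) n =
    (\<Union>i\<in>{i\<in>{0..n}. Suc N dvd n - i \<and> (n - i) div Suc N \<in> A (Suc N)}.
       (\<lambda>M. M + replicate_mset ((n - i) div Suc N) (Suc N)) ` restricted_partitions A N i)"
    (is "?L = (\<Union>i\<in>?I. ?f i ` _)")
proof (intro equalityI subsetI)
  fix M assume M: "M \<in> ?L"
  define c where "c = count M (Suc N)"
  define M' where "M' = filter_mset (\<lambda>p. p \<noteq> Suc N) M"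
  have M_eq: "M = M' + replicate_mset c (Suc N)"
    by (auto simp: multiset_eq_iff M'_def c_def)
  have sum: "sum_mset M' + c * Suc N = n"
    using M by (subst (asm) M_eq) (simp add: restricted_partitions_def mult.commute)
  have "M' \<in> restricted_partitions A N (sum_mset M')"
    using M by (auto simp: restricted_partitions_def M'_def le_Suc_eq)
  moreover have "c \<in> A (Suc N)"
  proof (cases "Suc N \<in># M")
    case True
    then show ?thesis
      using M by (simp add: restricted_partitions_def c_def)
  next
    case False
    then have "c = 0"
      by (simp add: c_def count_eq_zero_iff)
    then show ?thesis
      using assms by simp
  qed
  moreover have "n - sum_mset M' = c * Suc N"
    using sum by simp
  then have "(n - sum_mset M') div Suc N = c" "Suc N dvd n - sum_mset M'"
    by (metis nonzero_mult_div_cancel_right nat.distinct(1), metis dvd_triv_right)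
  ultimately show "M \<in> (\<Union>i\<in>?I. ?f i ` restricted_partitions A N i)"
    using sum M_eq by (intro UN_I[of "sum_mset M'"]) auto
next
  fix M assume "M \<in> (\<Union>i\<in>?I. ?f i ` restricted_partitions A N i)"
  then obtain i M' where i: "i \<in> ?I" and M': "M' \<in> restricted_partitions A N i" "M = ?f i M'"
    by blast
  have "Suc N \<notin># M'"
    using M' by (auto simp: restricted_partitions_def)
  then have "count M' (Suc N) = 0"
    by (simp add: count_eq_zero_iff)
  moreover have "i + (n - i) div Suc N * Suc N = n"
    using i by (simp add: dvd_div_mult_self del: mult_Suc_right)
  ultimately show "M \<in> ?L"
    using i M' by (auto simp: restricted_partitions_def split: if_splits)
qed

lemma card_restricted_partitions_Suc:
  assumes "\<And>p. 0 \<in> A p"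
  shows "card (restricted_partitions A (Suc N) n) =
    (\<Sum>i=0..n. card (restricted_partitions A N i) *
       of_bool (Suc N dvd n - i \<and> (n - i) div Suc N \<in> A (Suc N)))"
proof -
  let ?f = "\<lambda>i M. M + replicate_mset ((n - i) div Suc N) (Suc N)"
  let ?I = "{i\<in>{0..n}. Suc N dvd n - i \<and> (n - i) div Suc N \<in> A (Suc N)}"
  have disj: "?f i ` restricted_partitions A N i \<inter> ?f j ` restricted_partitions A N j = {}"
    if "i \<in> ?I" "j \<in> ?I" "i \<noteq> j" for i j
  proof -
    have False if M: "M \<in> restricted_partitions A N i" "M' \<in> restricted_partitions A N j"
      and eq: "?f i M = ?f j M'" for M M'
    proof -
      \<comment> \<open>Deleting the copies of \<open>Suc N\<close> recovers the smaller multiset,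
        whose sum determines the index.\<close>
      have "filter_mset (\<lambda>p. p \<noteq> Suc N) L = L" "filter_mset (\<lambda>p. p \<noteq> Suc N) (?f k L) = L"
        if "L \<in> restricted_partitions A N k'" for L k k'
        using that by (auto simp: restricted_partitions_def multiset_eq_iff not_in_iff subset_iff)
      then have "M = M'"
        using M eq by metis
      then show False
        using M \<open>i \<noteq> j\<close> by (auto simp: restricted_partitions_def)
    qed
    then show ?thesis by blast
  qed
  have "card (restricted_partitions A (Suc N) n) =
      (\<Sum>i\<in>?I. card (?f i ` restricted_partitions A N i))"
    unfolding restricted_partitions_Suc[of A, OF assms] using disj
    by (intro card_UN_disjoint) auto
  also have "\<dots> = (\<Sum>i\<in>?I. card (restricted_partitions A N i))"
    by (intro sum.cong refl card_image) (auto simp: inj_on_def)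
  also have "\<dots> = (\<Sum>i=0..n. card (restricted_partitions A N i) *
       of_bool (Suc N dvd n - i \<and> (n - i) div Suc N \<in> A (Suc N)))"
    by (intro sum.mono_neutral_cong_left) auto
  finally show ?thesis .
qed

lemma restricted_partitions_series:
  assumes "\<And>p. 0 \<in> A p"
  shows "Abs_fps (\<lambda>n. of_nat (card (restricted_partitions A N n))) =
    (\<Prod>p=1..N. part_series (A p) p :: 'a::comm_ring_1 fps)"
proof (induction N)
  case 0
  have "restricted_partitions A 0 n = (if n = 0 then {{#}} else {})" for n
    by (auto simp: restricted_partitions_def)
  then show ?case
    by (auto simp: fps_eq_iff)
next
  case (Suc N)
  have "Abs_fps (\<lambda>n. of_nat (card (restricted_partitions A (Suc N) n))) =
      Abs_fps (\<lambda>n. of_nat (card (restricted_partitions A N n))) *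
      (part_series (A (Suc N)) (Suc N) :: 'a fps)"
    by (simp add: fps_eq_iff fps_mult_nth card_restricted_partitions_Suc[of A, OF assms]
        part_series_def)
  then show ?case
    by (simp add: Suc)
qed

lemma part_series_UNIV:
  assumes "p > 0"
  shows "part_series UNIV p * (1 - fps_X ^ p) = (1 :: 'a::comm_ring_1 fps)"
proof (rule fps_ext)
  fix m
  have "m \<ge> p" if "p dvd m" "m > 0"
    using that by (simp add: dvd_imp_le)
  then show "(part_series UNIV p * (1 - fps_X ^ p)) $ m = (1 :: 'a fps) $ m"
    using assms by (auto simp: right_diff_distrib fps_X_power_mult_right_nth part_series_def
        dvd_diff_nat dest: dvd_diffD)
qed

lemma part_series_not_1:
  assumes "p > 0"
  shows "part_series (- {1}) p = (part_series UNIV p - fps_X ^ p :: 'a::comm_ring_1 fps)"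
proof -
  have "(p dvd m \<and> m div p = 1) = (m = p)" for m
    using assms by auto
  then show ?thesis
    by (auto simp: fps_eq_iff part_series_def)
qed

section \<open>Gauss's identity for the triangular numbers\<close>

definition triangular :: "nat \<Rightarrow> nat" where
  "triangular k = k * (k + 1) div 2"

lemma triangular_0 [simp]: "triangular 0 = 0"
  and triangular_Suc [simp]: "triangular (Suc k) = triangular k + Suc k"
  by (simp_all add: triangular_def)

lemma strict_mono_triangular: "strict_mono triangular"
  by (simp add: strict_mono_Suc_iff)

lemma triangular_eq_iff [simp]: "triangular i = triangular j \<longleftrightarrow> i = j"
  using strict_mono_triangular by (rule strict_mono_eq)

lemma le_triangular: "k \<le> triangular k"
  by (induction k) auto

lemma triangular_double: "triangular (2 * n) = n * (2 * n + 1)"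
  by (simp add: triangular_def)

lemma triangular_mult_3:
  "triangular (3 * i) = 9 * triangular i - 3 * i"
  "triangular (3 * i + 1) = 9 * triangular i + 1"
  "triangular (3 * i + 2) = 9 * triangular i + 3 * i + 3"
proof -
  \<comment> \<open>The additive form keeps truncated subtraction out of the induction.\<close>
  have *: "triangular (3 * i) + 3 * i = 9 * triangular i"
  proof (induction i)
    case (Suc i)
    have "3 * Suc i = Suc (Suc (Suc (3 * i)))"
      by simp
    then have "triangular (3 * Suc i) = triangular (3 * i) + 9 * i + 6"
      by (simp only: triangular_Suc)
    then show ?case
      using Suc by simp
  qed simp
  then show "triangular (3 * i) = 9 * triangular i - 3 * i"
    by simp
  show "triangular (3 * i + 1) = 9 * triangular i + 1"
    "triangular (3 * i + 2) = 9 * triangular i + 3 * i + 3"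
    using * by simp_all
qed

context
  fixes x :: "'a::comm_ring_1"
begin

text \<open>The q-Pochhammer symbol (q^2; q^2)_n at q = \<open>x\<close>; likewise
  \<open>odd_prod\<close> is (q; q^2)_n.\<close>

definition even_prod :: "nat \<Rightarrow> 'a" where
  "even_prod n = (\<Prod>k<n. 1 - x ^ (2 * k + 2))"

definition odd_prod :: "nat \<Rightarrow> 'a" where
  "odd_prod n = (\<Prod>k<n. 1 - x ^ (2 * k + 1))"

text \<open>The product over \<open>k\<close> is the quotient (q^2; q^2)_n / (q^2; q^2)_s written
  without division, which makes sense in any commutative ring.\<close>

definition shanks_term :: "nat \<Rightarrow> nat \<Rightarrow> 'a" where
  "shanks_term n s = (\<Prod>k=s..<n. 1 - x ^ (2 * k + 2)) * odd_prod s * x ^ (s * (2 * n + 1))"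

lemma shanks_term_Suc_left:
  assumes "s \<le> n"
  shows "shanks_term (Suc n) s = (1 - x ^ (2 * n + 2)) * x ^ (2 * s) * shanks_term n s"
proof -
  have "s * (2 * Suc n + 1) = 2 * s + s * (2 * n + 1)"
    by simp
  then show ?thesis
    using assms by (simp only: shanks_term_def power_add prod.atLeastLessThan_Suc mult_ac)
qed

lemma shanks_term_Suc_right:
  assumes "s < n"
  shows "(1 - x ^ (2 * s + 2)) * shanks_term n (Suc s) =
    (1 - x ^ (2 * s + 1)) * x ^ (2 * n + 1) * shanks_term n s"
proof -
  have "(\<Prod>k=s..<n. 1 - x ^ (2 * k + 2)) =
      (1 - x ^ (2 * s + 2)) * (\<Prod>k=Suc s..<n. 1 - x ^ (2 * k + 2))"
    using assms by (simp add: prod.atLeast_Suc_lessThan)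
  moreover have "x ^ (Suc s * (2 * n + 1)) = x ^ (2 * n + 1) * x ^ (s * (2 * n + 1))"
    by (simp only: mult_Suc power_add)
  moreover have "odd_prod (Suc s) = (1 - x ^ (2 * s + 1)) * odd_prod s"
    by (simp add: odd_prod_def)
  ultimately show ?thesis
    unfolding shanks_term_def by (simp only: mult_ac)
qed

text \<open>Shanks's finite form of Gauss's identity, with denominators cleared. Only the summand \<open>s = 0\<close>
  on the right, which is \<open>even_prod n\<close>, has terms of low order.\<close>

lemma shanks_identity:
  "odd_prod n * (\<Sum>s<2*n. x ^ triangular s) = (\<Sum>s<n. shanks_term n s)"
proof (induction n)
  case (Suc n)
  let ?R = "shanks_term n" and ?q = "x ^ (2 * n + 1)"
  have R: "?R n = odd_prod n * x ^ (n * (2 * n + 1))"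
    by (simp add: shanks_term_def)
  have q: "x ^ (2 * n + 2) * x ^ (2 * n) = ?q * ?q" "x ^ (2 * n + 2) = x * ?q"
    by (simp_all flip: power_add power_Suc)
  \<comment> \<open>The certificate \<open>(1 - x ^ (2 * s)) * ?R s\<close> vanishes at
    \<open>s = 0\<close>, so after summation only its value at \<open>s = n\<close>
    survives.\<close>
  have telescope: "shanks_term (Suc n) s - (1 - ?q) * ?R s =
      (1 - x ^ (2 * Suc s)) * ?R (Suc s) - (1 - x ^ (2 * s)) * ?R s" if "s < n" for s
  proof -
    have "(1 - x ^ (2 * Suc s)) * ?R (Suc s) = (1 - x ^ (2 * s) * x) * ?q * ?R s"
      using shanks_term_Suc_right[OF that] by (simp add: mult_ac)
    moreover have "shanks_term (Suc n) s = (1 - x * ?q) * x ^ (2 * s) * ?R s"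
      using shanks_term_Suc_left[of s n] that q(2) by simp
    ultimately show ?thesis
      by (simp only:) (simp add: algebra_simps)
  qed
  have "(\<Sum>s<Suc n. shanks_term (Suc n) s) - (1 - ?q) * (\<Sum>s<n. ?R s) =
      shanks_term (Suc n) n + (\<Sum>s<n. shanks_term (Suc n) s - (1 - ?q) * ?R s)"
    by (simp add: sum_subtractf sum_distrib_left)
  also have "(\<Sum>s<n. shanks_term (Suc n) s - (1 - ?q) * ?R s) =
      (\<Sum>s<n. (1 - x ^ (2 * Suc s)) * ?R (Suc s) - (1 - x ^ (2 * s)) * ?R s)"
    by (intro sum.cong refl telescope) auto
  also have "\<dots> = (1 - x ^ (2 * n)) * ?R n"
    by (subst sum_lessThan_telescope) simp
  also have "shanks_term (Suc n) n = (1 - x ^ (2 * n + 2)) * x ^ (2 * n) * ?R n"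
    by (rule shanks_term_Suc_left) simp
  also have "(1 - x ^ (2 * n + 2)) * x ^ (2 * n) * ?R n + (1 - x ^ (2 * n)) * ?R n =
      (1 - x ^ (2 * n + 2) * x ^ (2 * n)) * ?R n"
    by (simp add: algebra_simps)
  also have "\<dots> = (1 - ?q * ?q) * (odd_prod n * x ^ (n * (2 * n + 1)))"
    unfolding q(1) R ..
  also have "\<dots> = (1 - ?q) * odd_prod n * (x ^ (n * (2 * n + 1)) + x ^ (n * (2 * n + 1)) * ?q)"
    by (simp only: algebra_simps mult_1_left)
  \<comment> \<open>The two powers of \<open>x\<close> are the terms \<open>2 * n + 1\<close> and
    \<open>2 * n\<close> that the sum of triangular powers gains.\<close>
  also have "x ^ (n * (2 * n + 1)) * ?q = x ^ triangular (Suc (2 * n))"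
    unfolding triangular_Suc triangular_double power_add[of x "n * (2 * n + 1)"] by simp
  also have "x ^ (n * (2 * n + 1)) = x ^ triangular (2 * n)"
    by (simp only: triangular_double)
  finally show ?case
    unfolding Suc[symmetric] by (simp add: odd_prod_def algebra_simps)
qed (simp add: odd_prod_def)

end

section \<open>Gauss's product as a family of congruences modulo powers of q\<close>

lemma fps_X_power_dvd_iff: "fps_X ^ n dvd (f :: 'a::comm_ring_1 fps) \<longleftrightarrow> (\<forall>i<n. f $ i = 0)"
proof
  assume "\<forall>i<n. f $ i = 0"
  then have "f = fps_X ^ n * fps_shift n f"
    by (auto simp: fps_eq_iff fps_X_power_mult_nth)
  then show "fps_X ^ n dvd f" by (metis dvd_triv_left)
qed (auto simp: fps_X_power_mult_nth elim!: dvdE)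

text \<open>This is psi(e q); e = 1 and e = -1 give the two series f and g.\<close>

definition psi :: "'a::comm_ring_1 \<Rightarrow> 'a fps" where
  "psi e = Abs_fps (\<lambda>m. of_bool (m \<in> range triangular) * e ^ m)"

text \<open>By \<open>le_triangular\<close> the omitted terms have exponent at least
  \<open>2 * n\<close>. The range is the one in \<open>shanks_identity\<close>.\<close>

lemma psi_truncation:
  "fps_X ^ n dvd psi e - (\<Sum>s<2*n. (fps_const e * fps_X) ^ triangular s)"
  unfolding fps_X_power_dvd_iff
proof (intro allI impI)
  fix i assume "i < n"
  have "(\<Sum>s<2*n. (fps_const e * fps_X) ^ triangular s) $ i =
      (\<Sum>s<2*n. if triangular s = i then e ^ i else 0)"
    by (auto simp: fps_sum_nth power_mult_distrib fps_const_power intro!: sum.cong)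
  also have "\<dots> = psi e $ i"
  proof (cases "i \<in> range triangular")
    case True
    then obtain j where "i = triangular j" by blast
    moreover from this have "j < 2 * n"
      using le_triangular[of j] \<open>i < n\<close> by simp
    ultimately show ?thesis by (simp add: psi_def)
  qed (auto simp: psi_def intro!: sum.neutral)
  finally show "(psi e - (\<Sum>s<2*n. (fps_const e * fps_X) ^ triangular s)) $ i = 0"
    by simp
qed

text \<open>In Shanks's identity each summand with \<open>s > 0\<close> carries the exponent
  \<open>s * (2 * n + 1)\<close>, which is at least \<open>n\<close>, so modulo q^n only
  \<open>even_prod\<close> is left.\<close>

lemma gauss_psi:
  defines "x \<equiv> \<lambda>e. fps_const e * fps_X"
  shows "fps_X ^ n dvd odd_prod (x e) n * psi e - even_prod (x e) n"
proof -
  have "fps_X ^ n dvd x e ^ n"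
    by (simp add: x_def power_mult_distrib)
  have "fps_X ^ n dvd shanks_term (x e) n s" if "s \<noteq> 0" for s
  proof -
    have "n \<le> s * (2 * n + 1)"
      using that by (cases s) auto
    then have "x e ^ n dvd x e ^ (s * (2 * n + 1))"
      by (rule le_imp_power_dvd)
    with \<open>fps_X ^ n dvd x e ^ n\<close> show ?thesis
      unfolding shanks_term_def using dvd_trans dvd_mult by blast
  qed
  then have "fps_X ^ n dvd (\<Sum>s\<in>{..<n} - {0}. shanks_term (x e) n s)"
    by (intro dvd_sum) auto
  moreover have "fps_X ^ n dvd
      (\<Sum>s<n. shanks_term (x e) n s) - even_prod (x e) n - (\<Sum>s\<in>{..<n} - {0}. shanks_term (x e) n s)"
  \<comment> \<open>For \<open>n = 0\<close> there is no summand \<open>s = 0\<close> to split off,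
    but then the divisor is 1.\<close>
  proof (cases "n = 0")
    case False
    then have "(\<Sum>s<n. shanks_term (x e) n s) =
        shanks_term (x e) n 0 + (\<Sum>s\<in>{..<n} - {0}. shanks_term (x e) n s)"
      by (intro sum.remove) auto
    then show ?thesis
      by (simp add: shanks_term_def even_prod_def odd_prod_def atLeast0LessThan)
  qed simp
  moreover have "fps_X ^ n dvd
      odd_prod (x e) n * (psi e - (\<Sum>s<2*n. x e ^ triangular s))"
    using psi_truncation[of n e] unfolding x_def by (rule dvd_mult)
  ultimately have "fps_X ^ n dvd (\<Sum>s\<in>{..<n} - {0}. shanks_term (x e) n s) +
      ((\<Sum>s<n. shanks_term (x e) n s) - even_prod (x e) n -
        (\<Sum>s\<in>{..<n} - {0}. shanks_term (x e) n s)) +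
      odd_prod (x e) n * (psi e - (\<Sum>s<2*n. x e ^ triangular s))"
    by (intro dvd_add)
  then show ?thesis
    unfolding right_diff_distrib shanks_identity by simp
qed

section \<open>Power series over the field with three elements\<close>

lemma cube_eq_self [simp]: "a ^ 3 = (a :: 3)"
proof (cases a)
  case (of_int z)
  then have "z \<in> {0, 1, 2}" by auto
  then show ?thesis using of_int by auto
qed

lemma three_eq_0: "(3 :: 3 fps) = 0"
proof -
  have "(3 :: 3) = 0" by simp
  then have "fps_const (3 :: 3) = 0" by (simp only: fps_const_0_eq_0)
  then show ?thesis by (simp only: numeral_fps_const)
qed

lemma cube_add: "(a + b) ^ 3 = a ^ 3 + (b :: 3 fps) ^ 3"
proof -
  have "(a + b) ^ 3 = a ^ 3 + b ^ 3 + 3 * (a\<^sup>2 * b + a * b\<^sup>2)"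
    by (simp add: power2_eq_square power3_eq_cube algebra_simps)
  then show ?thesis
    by (simp only: three_eq_0) simp
qed

text \<open>This is F(q)^3 = F(q^3). Peel off the constant term: cubing c + q h gives c + q^3 h^3,
  which reduces exponent \<open>n\<close> to \<open>n - 3\<close>.\<close>

lemma cube_nth: "(f ^ 3) $ n = (if 3 dvd n then f $ (n div 3) else (0 :: 3))"
proof (induction n arbitrary: f rule: less_induct)
  case (less n)
  have "f = fps_const (f $ 0) + fps_X * fps_shift 1 f"
    by (auto simp: fps_eq_iff)
  then have "f ^ 3 = fps_const (f $ 0) + fps_X ^ 3 * fps_shift 1 f ^ 3"
    by (metis cube_add power_mult_distrib fps_const_power cube_eq_self)
  moreover have "n - 3 < n \<and> (3 dvd n - 3 \<longleftrightarrow> 3 dvd n) \<and> Suc ((n - 3) div 3) = n div 3" if "n \<ge> 3"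
    using that by (auto simp: le_div_geq dvd_minus_self)
  moreover have "\<not> 3 dvd n" if "0 < n" "n < 3"
    using that by (simp add: nat_dvd_not_less)
  ultimately show ?case
    using less[of "n - 3" "fps_shift 1 f"] by (cases "n = 0") (auto simp: fps_X_power_mult_nth)
qed

text \<open>Cubes have only exponents divisible by 3, so each summand occupies one residue
  class.\<close>

lemma trisection_nth:
  fixes x y z :: "3 fps"
  assumes "f = x ^ 3 + fps_X * y ^ 3 + fps_X\<^sup>2 * z ^ 3"
  shows "f $ (3 * n) = x $ n" "f $ (3 * n + 1) = y $ n" "f $ (3 * n + 2) = z $ n"
proof -
  have *: "\<not> 3 dvd 3 * n - Suc 0" "\<not> 3 dvd 3 * n - 2" if "n > 0"
    using that by presburger+
  have "\<not> 3 dvd Suc (3 * n)" "\<not> 3 dvd Suc (Suc (3 * n))"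
    by presburger+
  then show "f $ (3 * n) = x $ n" "f $ (3 * n + 1) = y $ n" "f $ (3 * n + 2) = z $ n"
    using assms * by (auto simp: cube_nth fps_X_power_mult_nth)
qed

text \<open>Constant term 1 makes \<open>h\<close> a unit; this replaces division by the finite
  products.\<close>

lemma fps_X_power_dvd_cancel:
  fixes h f :: "'a::comm_ring_1 fps"
  assumes "h $ 0 = 1" "fps_X ^ n dvd h * f"
  shows "fps_X ^ n dvd f"
proof -
  have "fps_left_inverse h 1 * h = 1"
    using assms(1) by (intro fps_left_inverse) simp
  then have "f = fps_left_inverse h 1 * (h * f)"
    by (simp flip: mult.assoc)
  then show ?thesis
    using assms(2) by (metis dvd_mult)
qed

lemma fps_X_power_dvd_imp_eq_0:
  "(\<And>n. fps_X ^ n dvd f) \<Longrightarrow> f = (0 :: 'a::comm_ring_1 fps)"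
  unfolding fps_X_power_dvd_iff fps_eq_iff by (metis fps_zero_nth lessI)

lemma odd_prod_nth_0: "x $ 0 = 0 \<Longrightarrow> odd_prod x n $ 0 = (1 :: 'a::comm_ring_1)"
  by (induction n) (auto simp: odd_prod_def)

section \<open>The 3-dissection of psi\<close>

lemma triangular_mod_3:
  "3 * n + 2 \<notin> range triangular"
  "3 * n + 1 \<in> range triangular \<longleftrightarrow> 3 dvd n \<and> n div 3 \<in> range triangular"
proof -
  \<comment> \<open>Write k = 3 i + r: by \<open>triangular_mult_3\<close> only r = 1 yields a
    non-multiple of 3.\<close>
  have 1: "\<exists>i. (k = 3 * i + 1 \<and> triangular k = 9 * triangular i + 1) \<or> 3 dvd triangular k" for k
  proof -
    have "\<exists>i. k = 3 * i \<or> k = 3 * i + 1 \<or> k = 3 * i + 2"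
      by presburger
    then obtain i where "k = 3 * i \<or> k = 3 * i + 1 \<or> k = 3 * i + 2"
      by blast
    moreover have "3 dvd 9 * triangular i - 3 * i" "3 dvd 9 * triangular i + 3 * i + 3"
      by presburger+
    ultimately show ?thesis
      by (metis triangular_mult_3)
  qed
  have 2: "\<not> 3 dvd 3 * n + 2" "\<not> 3 dvd 3 * n + 1" "3 * n + 2 \<noteq> 9 * i + 1" for i
    by presburger+
  show "3 * n + 2 \<notin> range triangular"
    using 1 2 by (metis rangeE)
  show "3 * n + 1 \<in> range triangular \<longleftrightarrow> 3 dvd n \<and> n div 3 \<in> range triangular"
  proof
    assume "3 * n + 1 \<in> range triangular"
    then obtain i where "3 * n + 1 = 9 * triangular i + 1"
      using 1 2(2) by (metis rangeE)
    then have "n = 3 * triangular i" by simp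
    then show "3 dvd n \<and> n div 3 \<in> range triangular" by simp
  next
    assume "3 dvd n \<and> n div 3 \<in> range triangular"
    then obtain i where "n = 3 * triangular i" by auto
    then have "3 * n + 1 = triangular (3 * i + 1)"
      by (simp only: triangular_mult_3)
    then show "3 * n + 1 \<in> range triangular" by (metis rangeI)
  qed
qed

lemma psi_trisection:
  "\<exists>a. psi e = a ^ 3 + fps_const e * fps_X * psi (e :: 3) ^ 9"
proof (intro exI fps_ext)
  fix m
  \<comment> \<open>By \<open>cube_nth\<close>, the cube of \<open>?a\<close> is exactly the part of
    \<open>psi e\<close> with exponents divisible by 3.\<close>
  let ?a = "Abs_fps (\<lambda>n. psi e $ (3 * n))"
  have 9: "(psi e ^ 9) $ n = (if 9 dvd n then psi e $ (n div 9) else 0)" for n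
  proof -
    have "psi e ^ 9 = (psi e ^ 3) ^ 3" by (simp flip: power_mult)
    moreover have "9 dvd n \<longleftrightarrow> 3 dvd n \<and> 3 dvd n div 3" by presburger
    ultimately show ?thesis by (simp only: cube_nth) (simp add: div_mult2_eq[symmetric])
  qed
  have rhs: "(?a ^ 3 + fps_const e * fps_X * psi e ^ 9) $ m =
      (if 3 dvd m then psi e $ m else 0) + (if m = 0 then 0 else e * (psi e ^ 9) $ (m - 1))"
    by (simp add: cube_nth mult.assoc)
  have "\<exists>n. m = 3 * n \<or> m = 3 * n + 1 \<or> m = 3 * n + 2"
    by presburger
  then obtain n where "m = 3 * n \<or> m = 3 * n + 1 \<or> m = 3 * n + 2"
    by blast
  then consider "m = 3 * n" | "m = 3 * n + 1" | "m = 3 * n + 2"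
    by blast
  then show "psi e $ m = (?a ^ 3 + fps_const e * fps_X * psi e ^ 9) $ m"
  proof cases
    case 1
    \<comment> \<open>The case \<open>m = 0\<close> is set apart since \<open>0 - 1 = 0\<close> is
      divisible by 9.\<close>
    then have "\<not> 9 dvd m - 1" if "m \<noteq> 0" using that by presburger
    with 1 show ?thesis unfolding rhs 9 by simp
  next
    case 2
    then have *: "\<not> 3 dvd m" "m \<noteq> 0" "9 dvd m - 1 \<longleftrightarrow> 3 dvd n" "(m - 1) div 9 = n div 3"
      by presburger+
    have "psi e $ m = (if 3 dvd n then e * psi e $ (n div 3) else 0)"
    proof (cases "3 dvd n")
      case True
      then obtain k where "n = 3 * k" by blast
      \<comment> \<open>Fermat's little theorem, used twice, turns the coefficient e^(9 k + 1) into
        e times e^k.\<close>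
      moreover have "e ^ (9 * k) = e ^ k"
      proof -
        have "e ^ (9 * k) = ((e ^ k) ^ 3) ^ 3" by (simp add: mult.commute del: cube_eq_self flip: power_mult)
        then show ?thesis by simp
      qed
      ultimately show ?thesis
        using triangular_mod_3(2)[of n] 2 by (simp add: psi_def)
    qed (use triangular_mod_3(2)[of n] 2 in \<open>simp add: psi_def\<close>)
    with * show ?thesis unfolding rhs 9 by simp
  next
    case 3
    then have "\<not> 3 dvd m" "\<not> 9 dvd m - 1" by presburger+
    then show ?thesis
      unfolding rhs 9 using triangular_mod_3(1)[of n] 3 by (simp add: psi_def)
  qed
qed

section \<open>The generating function of \<open>pond\<close> modulo 3\<close>

definition pond_mult :: "nat \<Rightarrow> nat set" where
  "pond_mult p = (if odd p then - {1} else UNIV)"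

text \<open>A partition of \<open>n\<close> has no part above \<open>n\<close>, so a single bound
  \<open>N\<close> serves all coefficients up to \<open>N\<close>.\<close>

lemma pond_eq_restricted:
  assumes "n \<le> N"
  shows "pond n = card (restricted_partitions pond_mult N n)"
proof -
  have "p \<le> N" if "p \<in># M" "sum_mset M = n" for p M
    using that assms by (auto dest!: multi_member_split)
  then have "{M. partition_of n M \<and> POND M} = restricted_partitions pond_mult N n"
    by (fastforce simp: partition_of_def POND_def restricted_partitions_def pond_mult_def Suc_le_eq)
  then show ?thesis by (simp add: pond_def)
qed

definition pond_series :: "3 fps" where
  "pond_series = Abs_fps (\<lambda>n. of_nat (pond n))"

text \<open>Parts up to \<open>2 * n\<close> comprise \<open>n\<close> odd and \<open>n\<close> even
  ones, matching the factors of \<open>odd_prod n\<close> and \<open>even_prod n\<close>.\<close>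

definition pond_prod :: "nat \<Rightarrow> 3 fps" where
  "pond_prod n = (\<Prod>p=1..2*n. part_series (pond_mult p) p)"

lemma pond_series_truncation: "fps_X ^ n dvd pond_series - pond_prod n"
proof -
  have "pond_prod n = Abs_fps (\<lambda>i. of_nat (card (restricted_partitions pond_mult (2 * n) i)))"
    unfolding pond_prod_def
    by (rule restricted_partitions_series[symmetric]) (simp add: pond_mult_def)
  then show ?thesis
    by (simp add: fps_X_power_dvd_iff pond_series_def pond_eq_restricted[of _ "2 * n"])
qed

text \<open>Modulo 3 an odd part \<open>p\<close> contributes
  \<open>(1 - q^p + q^(2p)) / (1 - q^p) = (1 + q^p)^2 / (1 - q^p)\<close>.\<close>

lemma pond_prod_eq:
  "pond_prod n * (even_prod fps_X n * odd_prod fps_X n) = (odd_prod (- fps_X) n)\<^sup>2"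
proof (induction n)
  case (Suc n)
  define x where "x = (fps_X ^ (2 * n + 1) :: 3 fps)"
  define y where "y = (fps_X ^ (2 * n + 2) :: 3 fps)"
  define u where "u = (part_series (pond_mult (2 * n + 1)) (2 * n + 1) :: 3 fps)"
  define v where "v = (part_series (pond_mult (2 * n + 2)) (2 * n + 2) :: 3 fps)"
  have v: "v * (1 - y) = 1"
    unfolding v_def y_def pond_mult_def using part_series_UNIV[of "2 * n + 2"] by simp
  have "u * (1 - x) = part_series UNIV (2 * n + 1) * (1 - x) - x * (1 - x)"
    unfolding u_def x_def pond_mult_def
    using part_series_not_1[of "2 * n + 1", where 'a = 3] by (simp add: left_diff_distrib)
  also have "\<dots> = 1 - x * (1 - x)"
    unfolding x_def by (subst part_series_UNIV) simp_all
  also have "\<dots> = (1 + x)\<^sup>2 - 3 * x"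
    by (simp add: power2_eq_square algebra_simps)
  finally have u: "u * (1 - x) = (1 + x)\<^sup>2"
    by (simp only: three_eq_0) simp
  have "pond_prod (Suc n) = pond_prod n * u * v"
    by (simp add: pond_prod_def u_def v_def)
  moreover have "even_prod fps_X (Suc n) = even_prod fps_X n * (1 - y)"
    by (simp add: even_prod_def y_def)
  moreover have "odd_prod fps_X (Suc n) = odd_prod fps_X n * (1 - x)"
    by (simp add: odd_prod_def x_def)
  moreover have "odd_prod (- fps_X) (Suc n) = odd_prod (- fps_X) n * (1 + x)"
    by (simp add: odd_prod_def x_def)
  ultimately have "pond_prod (Suc n) * (even_prod fps_X (Suc n) * odd_prod fps_X (Suc n)) =
      (pond_prod n * (even_prod fps_X n * odd_prod fps_X n)) * (u * (1 - x)) * (v * (1 - y))"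
    by (simp only: mult_ac)
  then show ?case
    unfolding Suc u v using \<open>odd_prod (- fps_X) (Suc n) = _\<close> by (simp add: power_mult_distrib)
qed (simp add: pond_prod_def even_prod_def odd_prod_def)

text \<open>With A, B, C the infinite products (q; q^2), (-q; q^2), (q^2; q^2), Gauss gives f = C/A
  and g = C/B, while the pond series is B^2/(A C). All is done modulo q^n for every n.\<close>

lemma pond_series_psi: "pond_series * (psi (- 1))\<^sup>2 = psi 1"
proof -
  define f g where "f = (psi 1 :: 3 fps)" and "g = (psi (- 1) :: 3 fps)"
  have "fps_X ^ n dvd pond_series * g\<^sup>2 - f" for n
  proof -
    define a b c where "a = (odd_prod fps_X n :: 3 fps)" and "b = (odd_prod (- fps_X) n :: 3 fps)"
      and "c = (even_prod fps_X n :: 3 fps)"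
    have neg: "fps_const (- 1) * fps_X = (- fps_X :: 3 fps)"
      by (simp flip: fps_const_neg)
    have 1: "fps_X ^ n dvd a * f - c"
      using gauss_psi[of n "1 :: 3"] by (simp add: a_def c_def f_def)
    \<comment> \<open>All exponents are even, so the sign of q disappears.\<close>
    have "even_prod (- fps_X) n = c"
      by (simp add: c_def even_prod_def)
    then have 2: "fps_X ^ n dvd b * g - c"
      using gauss_psi[of n "- 1 :: 3"] unfolding neg by (simp add: b_def g_def)
    have 3: "fps_X ^ n dvd pond_series - pond_prod n"
      by (rule pond_series_truncation)
    have "pond_prod n * (c * a) = b\<^sup>2"
      unfolding a_def b_def c_def by (rule pond_prod_eq)
    \<comment> \<open>The first three summands contain a factor divisible by
      \<open>fps_X ^ n\<close>; the last is zero by \<open>pond_prod_eq\<close>.\<close>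
    moreover have "a * b\<^sup>2 * (pond_series * g\<^sup>2 - f) =
        a * (b * g)\<^sup>2 * (pond_series - pond_prod n)
        + a * pond_prod n * (b * g + c) * (b * g - c) - b\<^sup>2 * (a * f - c)
        + (pond_prod n * (c * a) - b\<^sup>2) * c"
      by (simp add: power2_eq_square algebra_simps)
    ultimately have "fps_X ^ n dvd a * b\<^sup>2 * (pond_series * g\<^sup>2 - f)"
      using 1 2 3 by (simp add: dvd_add dvd_diff)
    moreover have "(a * b\<^sup>2) $ 0 = 1"
      by (simp add: a_def b_def odd_prod_nth_0 fps_power_zeroth)
    ultimately show ?thesis
      by (rule fps_X_power_dvd_cancel[rotated])
  qed
  then show ?thesis
    using fps_X_power_dvd_imp_eq_0[of "pond_series * g\<^sup>2 - f"] by (simp add: f_def g_def)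
qed

section \<open>Extraction of residue classes and the induction\<close>

definition kernel_series :: "3 fps" where
  "kernel_series = psi 1 ^ 3 * (psi (- 1))\<^sup>2"

text \<open>With h = 1/g the series is f g h^3, and the cube h^3 respects the dissection. Exponents
  2 modulo 3 arise only from (q f^9)(-q g^9) h^3, the cube of -f^3 g^2 times q^2.\<close>

lemma pond_series_3n_plus_2: "pond_series $ (3 * n + 2) = - kernel_series $ n"
proof -
  define f g where "f = (psi 1 :: 3 fps)" and "g = (psi (- 1) :: 3 fps)"
  obtain a where a: "f = a ^ 3 + fps_X * f ^ 9"
    using psi_trisection[of 1] by (auto simp: f_def)
  obtain b where b: "g = b ^ 3 - fps_X * g ^ 9"
    using psi_trisection[of "- 1"] by (auto simp: g_def simp flip: fps_const_neg)
  have "g $ 0 = 1"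
    by (simp add: g_def psi_def image_iff exI[of _ 0])
  then obtain h where h: "h * g = 1"
    using fps_left_inverse[of 1 g] by auto
  have "pond_series * g ^ 3 = (pond_series * g\<^sup>2) * g"
    by (simp add: power2_eq_square power3_eq_cube mult.assoc)
  also have "pond_series * g\<^sup>2 = f"
    unfolding f_def g_def by (rule pond_series_psi)
  finally have "pond_series * g ^ 3 = f * g" .
  moreover have "pond_series * (h * g) ^ 3 = pond_series * g ^ 3 * h ^ 3"
    by (simp add: power_mult_distrib mult_ac)
  ultimately have "pond_series * (h * g) ^ 3 = f * g * h ^ 3"
    by simp
  then have "pond_series = f * g * h ^ 3"
    by (simp add: h)
  also have "f * g = (a ^ 3 + fps_X * f ^ 9) * (b ^ 3 - fps_X * g ^ 9)"
    by (simp only: a[symmetric] b[symmetric])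
  also have "\<dots> * h ^ 3 = (a * b * h) ^ 3
      + fps_X * ((f ^ 3 * b * h) ^ 3 + (- a * g ^ 3 * h) ^ 3)
      + fps_X\<^sup>2 * (- (f ^ 3 * g ^ 3 * h)) ^ 3"
    by (simp add: power_mult_distrib power2_eq_square algebra_simps)
  also have "g ^ 3 = g\<^sup>2 * g"
    by (simp flip: power_Suc2)
  also have "f ^ 3 * (g\<^sup>2 * g) * h = f ^ 3 * g\<^sup>2 * (h * g)"
    by (simp only: mult_ac)
  also have "(f ^ 3 * b * h) ^ 3 + (- a * (g\<^sup>2 * g) * h) ^ 3 =
      (f ^ 3 * b * h + - a * (g\<^sup>2 * g) * h) ^ 3"
    by (rule cube_add[symmetric])
  finally have "pond_series $ (3 * n + 2) = (- (f ^ 3 * g\<^sup>2 * (h * g))) $ n"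
    by (rule trisection_nth(3))
  then show ?thesis
    unfolding h by (simp add: kernel_series_def f_def g_def)
qed

text \<open>Two dissections in a row: 9 n + 8 = 3 (3 n + 2) + 2 and 9 n + 5 = 3 (3 n + 1) + 2. In
  the second, g^6 is a cube, so only f is dissected, and f has no exponents 2 modulo 3.\<close>

lemma kernel_series_nth:
  "kernel_series $ (9 * n + 8) = 0"
  "kernel_series $ (9 * n + 5) = kernel_series $ n"
proof -
  define f g where "f = (psi 1 :: 3 fps)" and "g = (psi (- 1) :: 3 fps)"
  obtain a where a: "f = a ^ 3 + fps_X * f ^ 9"
    using psi_trisection[of 1] by (auto simp: f_def)
  obtain b where b: "g = b ^ 3 - fps_X * g ^ 9"
    using psi_trisection[of "- 1"] by (auto simp: g_def simp flip: fps_const_neg)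
  have "kernel_series = f ^ 3 * (b ^ 3 - fps_X * g ^ 9)\<^sup>2"
    by (simp only: b[symmetric]) (simp add: kernel_series_def f_def g_def)
  \<comment> \<open>The cross term of the square has coefficient -2, written as 1 - 3 to reach the
    form of \<open>trisection_nth\<close>.\<close>
  also have "\<dots> = (f * b\<^sup>2) ^ 3 + fps_X * (f * b * g ^ 3) ^ 3 + fps_X\<^sup>2 * (f * g ^ 6) ^ 3
      - 3 * (fps_X * (f * b * g ^ 3) ^ 3)"
    by (simp add: power_mult_distrib power2_eq_square algebra_simps flip: power_mult power_add)
  finally have "kernel_series =
      (f * b\<^sup>2) ^ 3 + fps_X * (f * b * g ^ 3) ^ 3 + fps_X\<^sup>2 * (f * g ^ 6) ^ 3"
    by (simp only: three_eq_0) simp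
  note 1 = trisection_nth(3)[OF this]
  have "f * g ^ 6 = (a ^ 3 + fps_X * f ^ 9) * g ^ 6"
    by (simp only: a[symmetric])
  also have "\<dots> = (a * g\<^sup>2) ^ 3 + fps_X * kernel_series ^ 3 + fps_X\<^sup>2 * 0 ^ 3"
    by (simp add: kernel_series_def f_def g_def power_mult_distrib algebra_simps flip: power_mult)
  finally have 2: "f * g ^ 6 = (a * g\<^sup>2) ^ 3 + fps_X * kernel_series ^ 3 + fps_X\<^sup>2 * 0 ^ 3" .
  show "kernel_series $ (9 * n + 8) = 0"
    using 1[of "3 * n + 2"] trisection_nth(3)[OF 2, of n] by (simp add: add.commute)
  show "kernel_series $ (9 * n + 5) = kernel_series $ n"
    using 1[of "3 * n + 1"] trisection_nth(2)[OF 2, of n] by (simp add: add.commute)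
qed

lemma kernel_series_eq_0:
  assumes "\<alpha> \<ge> 1"
  shows "\<exists>m. 3 ^ (2 * \<alpha> + 1) * n + (23 * 3 ^ (2 * \<alpha>) + 1) div 8 = 3 * m + 2 \<and> kernel_series $ m = 0"
  using assms
proof (induction \<alpha> rule: dec_induct)
  case base
  \<comment> \<open>Here the argument is 27 n + 26 = 3 (9 n + 8) + 2.\<close>
  show ?case
    using kernel_series_nth(1)[of n] by (intro exI[of _ "9 * n + 8"]) simp
next
  case (step \<alpha>)
  then obtain m where
    m: "3 ^ (2 * \<alpha> + 1) * n + (23 * 3 ^ (2 * \<alpha>) + 1) div 8 = 3 * m + 2" "kernel_series $ m = 0"
    by blast
  obtain d :: nat where d: "23 * 3 ^ (2 * \<alpha>) + 1 = 8 * d"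
    using eight_dvd_offset by blast
  \<comment> \<open>The offset passes from d to 9 d - 1, so the argument 3 m + 2 passes to 9 (3 m +
    2) - 1 = 3 (9 m + 5) + 2; positivity of \<open>d\<close> makes the subtraction genuine.\<close>
  have "(23 * 3 ^ (2 * Suc \<alpha>) + 1) div 8 = 9 * d - 1"
    using d by simp
  moreover have "d > 0" using d by (cases d) auto
  ultimately have "3 ^ (2 * Suc \<alpha> + 1) * n + (23 * 3 ^ (2 * Suc \<alpha>) + 1) div 8 = 3 * (9 * m + 5) + 2"
    using m(1) d by simp
  then show ?case
    using m(2) kernel_series_nth(2)[of m] by metis
qed

theorem theorem5:
  fixes \<alpha> n :: nat
  assumes "\<alpha> \<ge> 1"
  shows "[pond (3 ^ (2 * \<alpha> + 1) * n + (23 * 3 ^ (2 * \<alpha>) + 1) div 8) = 0] (mod 3)"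
proof -
  obtain m where
    m: "3 ^ (2 * \<alpha> + 1) * n + (23 * 3 ^ (2 * \<alpha>) + 1) div 8 = 3 * m + 2" "kernel_series $ m = 0"
    using kernel_series_eq_0[OF assms] by blast
  have "of_nat (pond (3 * m + 2)) = (0 :: 3)"
    using pond_series_3n_plus_2[of m] m(2) by (simp add: pond_series_def)
  \<comment> \<open>The type \<open>3\<close> has characteristic 3.\<close>
  then have "3 dvd pond (3 * m + 2)"
    by (simp add: of_nat_eq_0_iff_char_dvd)
  then show ?thesis
    unfolding m(1) by (simp add: cong_0_iff)
qed

end
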